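(* Let $p$ be an odd prime, $n\geqslant1$ and $0\leqslant k<n$. For all non-negative integers $e_{k+1},\ldots,e_n$, in $E(x_1,\ldots,x_n)\otimes P(y_1,\ldots,y_n)$, $$[k;e_{k+1},\ldots,e_{n-1},e_n+n]=\sum_{s=0}^{n-1}(-1)^{n+s-1}\,[k;e_{k+1},\ldots,e_{n-1},e_n+s]\;Q_{n,s}^{p^{e_n}}.$$
   Context: $E(x_1,\ldots,x_n)\otimes P(y_1,\ldots,y_n)=H^*(B(\mathbb Z/p)^n;\mathbb Z/p)$ is the tensor product of the exterior algebra on $x_1,\ldots,x_n$ ($\dim x_i=1$) and the polynomial algebra on $y_1,\ldots,y_n$ ($\dim y_i=2$) over $\mathbb Z/p$. For non-negative integers $a_{k+1},\ldots,a_n$, M\`ui's invariant $[k;a_{k+1},\ldots,a_n]$ is the "determinant" $\frac1{k!}\det$ of the $n\times n$ array whose first $k$ rows are $(x_1,\ldots,x_n)$ and whose remaining rows are $(y_1^{p^{a_j}},\ldots,y_n^{p^{a_j}})$, $j=k+1,\ldots,n$. Precisely, $$[k;a_{k+1},\ldots,a_n]=\sum_I \operatorname{sign}(\sigma_I)\,x_{i_1}\cdots x_{i_k}\,\det\big(y_{i_u}^{p^{a_v}}\big)_{k+1\leqslant u,v\leqslant n},$$ the sum over all $k$-element subsets $I=\{i_1<\cdots<i_k\}$ of $\{1,\ldots,n\}$ with complement $\{i_{k+1}<\cdots<i_n\}$, and $\sigma_I$ the permutation $j\mapsto i_j$. For $k=0$ write $[a_1,\ldots,a_n]=\det(y_i^{p^{a_j}})$.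 Set $L_{n,s}=[0,\ldots,\hat s,\ldots,n]$ ($s$ omitted) for $0\leqslant s\leqslant n$ and $L_n=L_{n,n}=[0,\ldots,n-1]$. Each $L_{n,s}$ is divisible by $L_n$ in $P(y_1,\ldots,y_n)$, and the Dickson invariants are $Q_{n,s}=L_{n,s}/L_n$. *)

theory Defs
  imports
    "HOL-Library.Poly_Mapping"
    "HOL-Combinatorics.Permutations"
    "Jordan_Normal_Form.Determinant"
    "Berlekamp_Zassenhaus.Finite_Field"
begin

section \<open>Exterior algebras\<close>

text \<open>
  The exterior algebra over a commutative ring \<open>'r\<close> on generators $x_i$, one for each natural
  number $i$. An element is the finitely supported family of its coefficients with respect to
  the basis $x_I = x_{i_1} \cdots x_{i_k}$, where $I = \{i_1 < \cdots < i_k\}$ is a finite set.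
\<close>

typedef (overloaded) 'r ext =
  "{f :: nat set \<Rightarrow> 'r::zero. finite {I. f I \<noteq> 0} \<and> (\<forall>I. f I \<noteq> 0 \<longrightarrow> finite I)}"
  morphisms ext_coeff Abs_ext
  by (rule exI[of _ "\<lambda>_. 0"]) simp

setup_lifting type_definition_ext

lemma ext_coeff_infinite: "infinite I \<Longrightarrow> ext_coeff a I = 0"
  using ext_coeff[of a] by blast

lemma ext_eqI:
  assumes "\<And>I. finite I \<Longrightarrow> ext_coeff a I = ext_coeff b I"
  shows "a = b"
proof -
  have "ext_coeff a I = ext_coeff b I" for I
    using assms[of I] ext_coeff_infinite[of I a] ext_coeff_infinite[of I b]
    by (cases "finite I") simp_all
  then show ?thesis
    by (simp add: ext_coeff_inject[symmetric] fun_eq_iff)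
qed

text \<open>
  For disjoint \<open>I\<close> and \<open>J\<close>, reordering gives $x_I x_J = (-1)^m x_{I \cup J}$, where $m$ is the
  number of pairs $(i,j) \in I \times J$ with $j < i$.
\<close>

definition ext_sign :: "nat set \<Rightarrow> nat set \<Rightarrow> 'r::ring_1" where
  "ext_sign I J = (- 1) ^ card {(i, j). i \<in> I \<and> j \<in> J \<and> j < i}"

lemma ext_sign_empty [simp]: "ext_sign {} J = 1" "ext_sign I {} = 1"
  by (simp_all add: ext_sign_def)

lemma finite_inversions:
  "finite I \<Longrightarrow> finite J \<Longrightarrow> finite {(i, j). i \<in> I \<and> j \<in> J \<and> j < (i::nat)}"
  by (rule finite_subset[of _ "I \<times> J"]) auto

lemma ext_sign_Un_left:
  assumes "finite I" "finite J" "finite K" "I \<inter> J = {}"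
  shows "ext_sign (I \<union> J) K = ext_sign I K * ext_sign J K"
proof -
  have "{(i, j). i \<in> I \<union> J \<and> j \<in> K \<and> j < i} =
    {(i, j). i \<in> I \<and> j \<in> K \<and> j < i} \<union> {(i, j). i \<in> J \<and> j \<in> K \<and> j < i}"
    by auto
  moreover have "card \<dots> =
    card {(i, j). i \<in> I \<and> j \<in> K \<and> j < i} + card {(i, j). i \<in> J \<and> j \<in> K \<and> j < i}"
    using assms by (intro card_Un_disjoint finite_inversions) auto
  ultimately show ?thesis
    by (simp add: ext_sign_def power_add)
qed

lemma ext_sign_Un_right:
  assumes "finite I" "finite J" "finite K" "J \<inter> K = {}"
  shows "ext_sign I (J \<union> K) = ext_sign I J * ext_sign I K"
proof -
  have "{(i, j). i \<in> I \<and> j \<in> J \<union> K \<and> j < i} =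
    {(i, j). i \<in> I \<and> j \<in> J \<and> j < i} \<union> {(i, j). i \<in> I \<and> j \<in> K \<and> j < i}"
    by auto
  moreover have "card \<dots> =
    card {(i, j). i \<in> I \<and> j \<in> J \<and> j < i} + card {(i, j). i \<in> I \<and> j \<in> K \<and> j < i}"
    using assms by (intro card_Un_disjoint finite_inversions) auto
  ultimately show ?thesis
    by (simp add: ext_sign_def power_add)
qed

lemma ext_sign_cases: "ext_sign I J = (1::'r::ring_1) \<or> ext_sign I J = (- 1 :: 'r)"
  by (simp add: ext_sign_def minus_one_power_iff)

lemma ext_sign_mult_commute: "ext_sign I J * a = a * (ext_sign I J :: 'r::ring_1)"
  using ext_sign_cases[where 'r='r, of I J] by auto

instantiation ext :: (ab_group_add) ab_group_add
begin

lift_definition zero_ext :: "'a ext" is "\<lambda>_. 0" by simp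

lift_definition plus_ext :: "'a ext \<Rightarrow> 'a ext \<Rightarrow> 'a ext" is "\<lambda>f g I. f I + g I"
proof -
  fix f g :: "nat set \<Rightarrow> 'a"
  assume *: "finite {I. f I \<noteq> 0} \<and> (\<forall>I. f I \<noteq> 0 \<longrightarrow> finite I)"
    "finite {I. g I \<noteq> 0} \<and> (\<forall>I. g I \<noteq> 0 \<longrightarrow> finite I)"
  have "{I. f I + g I \<noteq> 0} \<subseteq> {I. f I \<noteq> 0} \<union> {I. g I \<noteq> 0}" by auto
  with * show "finite {I. f I + g I \<noteq> 0} \<and> (\<forall>I. f I + g I \<noteq> 0 \<longrightarrow> finite I)"
    by (auto intro: finite_subset)
qed

lift_definition uminus_ext :: "'a ext \<Rightarrow> 'a ext" is "\<lambda>f I. - f I" by simp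

definition minus_ext :: "'a ext \<Rightarrow> 'a ext \<Rightarrow> 'a ext" where
  "minus_ext a b = a + (- b)"

instance
  by standard (transfer; simp add: ac_simps; fail | simp add: minus_ext_def)+

end

instantiation ext :: (ring_1) ring_1
begin

lift_definition one_ext :: "'a ext" is "\<lambda>I. if I = {} then 1 else 0" by simp

lift_definition times_ext :: "'a ext \<Rightarrow> 'a ext \<Rightarrow> 'a ext" is
  "\<lambda>f g K. if finite K then \<Sum>I\<in>Pow K. ext_sign I (K - I) * (f I * g (K - I)) else 0"
proof -
  fix f g :: "nat set \<Rightarrow> 'a"
  let ?h = "\<lambda>K. if finite K then \<Sum>I\<in>Pow K. ext_sign I (K - I) * (f I * g (K - I)) else 0"
  assume *: "finite {I. f I \<noteq> 0} \<and> (\<forall>I. f I \<noteq> 0 \<longrightarrow> finite I)"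
    "finite {I. g I \<noteq> 0} \<and> (\<forall>I. g I \<noteq> 0 \<longrightarrow> finite I)"
  have "{K. ?h K \<noteq> 0} \<subseteq> (\<lambda>(I, J). I \<union> J) ` ({I. f I \<noteq> 0} \<times> {I. g I \<noteq> 0})"
  proof
    fix K assume "K \<in> {K. ?h K \<noteq> 0}"
    then have "(\<Sum>I\<in>Pow K. ext_sign I (K - I) * (f I * g (K - I))) \<noteq> 0"
      by (auto split: if_splits)
    then obtain I where "I \<in> Pow K" "ext_sign I (K - I) * (f I * g (K - I)) \<noteq> 0"
      by (rule sum.not_neutral_contains_not_neutral)
    then have "f I \<noteq> 0" "g (K - I) \<noteq> 0" "K = I \<union> (K - I)" by auto
    then show "K \<in> (\<lambda>(I, J). I \<union> J) ` ({I. f I \<noteq> 0} \<times> {I. g I \<noteq> 0})"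
      by (auto intro!: image_eqI[of _ _ "(I, K - I)"])
  qed
  then have "finite {K. ?h K \<noteq> 0}"
    by (rule finite_subset) (use * in auto)
  then show "finite {K. ?h K \<noteq> 0} \<and> (\<forall>K. ?h K \<noteq> 0 \<longrightarrow> finite K)"
    by (metis (lifting))
qed

lemma ext_coeff_times:
  "finite K \<Longrightarrow> ext_coeff (a * b) K =
    (\<Sum>I\<in>Pow K. ext_sign I (K - I) * (ext_coeff a I * ext_coeff b (K - I)))"
  by (simp add: times_ext.rep_eq)

instance
proof
  fix a b c :: "'a ext"
  show "a * b * c = a * (b * c)"
  proof (rule ext_eqI)
    fix K :: "nat set" assume K: "finite K"
    define f g h where "f = ext_coeff a" and "g = ext_coeff b" and "h = ext_coeff c"
    have fin: "finite L" if "L \<subseteq> K" for L using K that by (rule finite_subset[rotated])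
    have "ext_coeff (a * b * c) K = (\<Sum>L\<in>Pow K. ext_sign L (K - L) *
        ((\<Sum>I\<in>Pow L. ext_sign I (L - I) * (f I * g (L - I))) * h (K - L)))"
      unfolding f_def g_def h_def ext_coeff_times[OF K]
      by (intro sum.cong refl) (simp add: ext_coeff_times[OF fin])
    also have "\<dots> = (\<Sum>(L, I)\<in>(SIGMA L:Pow K. Pow L). ext_sign L (K - L) *
        (ext_sign I (L - I) * (f I * g (L - I)) * h (K - L)))"
      using K fin by (simp add: sum_distrib_left sum_distrib_right sum.Sigma)
    also have "\<dots> = (\<Sum>(I, J)\<in>(SIGMA I:Pow K. Pow (K - I)). ext_sign I (K - I) *
        (f I * (ext_sign J (K - I - J) * (g J * h (K - I - J)))))"
    proof -
      have signs: "ext_sign I (K - I) *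
          (f I * (ext_sign (L - I) (K - I - (L - I)) * (g (L - I) * h (K - I - (L - I))))) =
          ext_sign L (K - L) * (ext_sign I (L - I) * (f I * g (L - I)) * h (K - L))"
        if LI: "L \<subseteq> K" "I \<subseteq> L" for L I
      proof -
        define J M where "J = L - I" and "M = K - L"
        have eqs: "L = I \<union> J" "K - I = J \<union> M" "K - I - J = M"
          using LI by (auto simp: J_def M_def)
        have dis: "I \<inter> J = {}" "J \<inter> M = {}" by (auto simp: J_def M_def)
        have f3: "finite I" "finite J" "finite M"
          using LI fin K by (auto simp: J_def M_def)
        have s1: "ext_sign L M = ext_sign I M * (ext_sign J M :: 'a)"
          unfolding eqs(1) using f3 dis by (intro ext_sign_Un_left)
        have s2: "ext_sign I (K - I) = ext_sign I J * (ext_sign I M :: 'a)"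
          unfolding eqs(2) using f3 dis by (intro ext_sign_Un_right)
        have "ext_sign I (K - I) * (f I * (ext_sign J M * (g J * h M))) =
            ext_sign L M * (ext_sign I J * (f I * g J) * h M)"
          unfolding s1 s2
          using ext_sign_cases[where 'r='a, of I J] ext_sign_cases[where 'r='a, of I M]
            ext_sign_cases[where 'r='a, of J M]
          by (elim disjE) (simp_all add: mult.assoc)
        then show ?thesis
          by (simp only: J_def[symmetric] M_def[symmetric] eqs(3))
      qed
      show ?thesis
        by (rule sum.reindex_bij_witness[of _ "\<lambda>(I, J). (I \<union> J, I)" "\<lambda>(L, I). (I, L - I)"])
          (auto simp: signs)
    qed
    also have "\<dots> = (\<Sum>I\<in>Pow K. ext_sign I (K - I) *
        (f I * (\<Sum>J\<in>Pow (K - I). ext_sign J (K - I - J) * (g J * h (K - I - J)))))"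
      using K fin by (simp add: sum_distrib_left sum.Sigma)
    also have "\<dots> = ext_coeff (a * (b * c)) K"
      unfolding f_def g_def h_def ext_coeff_times[OF K]
      by (intro sum.cong refl) (simp add: ext_coeff_times fin)
    finally show "ext_coeff (a * b * c) K = ext_coeff (a * (b * c)) K" .
  qed
  show "1 * a = a"
  proof (rule ext_eqI)
    fix K :: "nat set" assume K: "finite K"
    have "ext_coeff (1 * a) K =
        (\<Sum>I\<in>Pow K. if I = {} then ext_sign I (K - I) * ext_coeff a (K - I) else 0)"
      unfolding ext_coeff_times[OF K] one_ext.rep_eq by (intro sum.cong) auto
    then show "ext_coeff (1 * a) K = ext_coeff a K"
      using K by simp
  qed
  show "a * 1 = a"
  proof (rule ext_eqI)
    fix K :: "nat set" assume K: "finite K"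
    have "ext_coeff (a * 1) K =
        (\<Sum>I\<in>Pow K. if I = K then ext_sign I (K - I) * ext_coeff a I else 0)"
      unfolding ext_coeff_times[OF K] one_ext.rep_eq by (intro sum.cong) auto
    then show "ext_coeff (a * 1) K = ext_coeff a K"
      using K by simp
  qed
  show "(a + b) * c = a * c + b * c" "a * (b + c) = a * b + a * c"
    by (rule ext_eqI; simp add: times_ext.rep_eq plus_ext.rep_eq algebra_simps sum.distrib)+
  show "(0::'a ext) \<noteq> 1"
    by transfer (metis zero_neq_one)
qed

end

lift_definition ext_const :: "'r::zero \<Rightarrow> 'r ext" is "\<lambda>c I. if I = {} then c else 0"
  by simp

lift_definition ext_gen :: "nat \<Rightarrow> 'r::ring_1 ext" is "\<lambda>i I. if I = {i} then 1 else 0"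
  by simp

lemma ext_coeff_const_mult:
  fixes c :: "'r::ring_1"
  shows "ext_coeff (ext_const c * a) K = c * ext_coeff a K"
proof (cases "finite K")
  case True
  have "ext_coeff (ext_const c * a) K =
      (\<Sum>I\<in>Pow K. if I = {} then ext_sign I (K - I) * (c * ext_coeff a (K - I)) else 0)"
    unfolding ext_coeff_times[OF True] ext_const.rep_eq by (intro sum.cong) auto
  then show ?thesis using True by simp
next
  case False
  then show ?thesis by (simp add: ext_coeff_infinite)
qed

lemma ext_coeff_mult_const:
  fixes c :: "'r::ring_1"
  shows "ext_coeff (a * ext_const c) K = ext_coeff a K * c"
proof (cases "finite K")
  case True
  have "ext_coeff (a * ext_const c) K =
      (\<Sum>I\<in>Pow K. if I = K then ext_sign I (K - I) * (ext_coeff a I * c) else 0)"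
    unfolding ext_coeff_times[OF True] ext_const.rep_eq by (intro sum.cong) auto
  then show ?thesis using True by simp
next
  case False
  then show ?thesis by (simp add: ext_coeff_infinite)
qed

lemma ext_const_commute: "ext_const c * a = a * ext_const (c :: 'r::comm_ring_1)"
  by (rule ext_eqI) (simp add: ext_coeff_const_mult ext_coeff_mult_const mult.commute)

lemma ext_const_add: "ext_const (c + d) = ext_const c + ext_const (d :: 'r::ring_1)"
  by transfer auto

lemma ext_const_mult: "ext_const (c * d) = ext_const c * ext_const (d :: 'r::ring_1)"
  by (rule ext_eqI) (simp add: ext_coeff_const_mult, simp add: ext_const.rep_eq)

lemma ext_const_1 [simp]: "ext_const 1 = (1 :: 'r::ring_1 ext)"
  by transfer auto

lemma ext_coeff_gen_mult:
  fixes a :: "'r::ring_1 ext"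
  shows "ext_coeff (ext_gen i * a) K =
    (if finite K \<and> i \<in> K then ext_sign {i} (K - {i}) * ext_coeff a (K - {i}) else 0)"
proof (cases "finite K")
  case True
  have "ext_coeff (ext_gen i * a) K =
      (\<Sum>I\<in>Pow K. if I = {i} then ext_sign I (K - I) * ext_coeff a (K - I) else 0)"
    unfolding ext_coeff_times[OF True] ext_gen.rep_eq by (intro sum.cong) auto
  then show ?thesis using True by simp
next
  case False
  then show ?thesis by (simp add: times_ext.rep_eq)
qed

lemma ext_gen_square: "ext_gen i * ext_gen i = (0 :: 'r::ring_1 ext)"
  by (rule ext_eqI) (auto simp: ext_coeff_gen_mult ext_gen.rep_eq zero_ext.rep_eq)

lemma ext_gen_anticommute:
  assumes "i \<noteq> j"
  shows "ext_gen i * ext_gen j = - (ext_gen j * ext_gen i :: 'r::ring_1 ext)"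
proof (rule ext_eqI)
  fix K :: "nat set" assume "finite K"
  have s: "ext_sign {u} {v} = (if v < u then - 1 else 1 :: 'r)" for u v
  proof -
    have "{(i, j). i \<in> {u} \<and> j \<in> {v} \<and> j < i} = (if v < u then {(u, v)} else {})"
      by auto
    then show ?thesis by (simp only: ext_sign_def) simp
  qed
  have *: "i \<in> K \<and> K - {i} = {j} \<longleftrightarrow> K = {i, j}" "j \<in> K \<and> K - {j} = {i} \<longleftrightarrow> K = {i, j}"
    using assms by auto
  show "ext_coeff (ext_gen i * ext_gen j) K = ext_coeff (- (ext_gen j * ext_gen i :: 'r ext)) K"
  proof (cases "K = {i, j}")
    case True
    then have "K - {i} = {j}" "K - {j} = {i}" using assms by auto
    then show ?thesis
      using True assms
      by (auto simp: ext_coeff_gen_mult uminus_ext.rep_eq ext_gen.rep_eq s)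
  next
    case False
    then show ?thesis
      using * by (auto simp: ext_coeff_gen_mult uminus_ext.rep_eq ext_gen.rep_eq)
  qed
qed


section \<open>The algebra $E(x_1,\ldots,x_n) \otimes P(y_1,\ldots,y_n)$\<close>

text \<open>
  \<open>'p ypoly\<close> is the ring of polynomials over $\mathbb{Z}/p$ in variables $y_i$ indexed by the
  natural numbers, where $p$ is \<open>CARD('p)\<close>. Since the $y_i$ have even degree, $E \otimes P$ is
  the exterior algebra over the ring $P$. The algebras on $n$ generators are the subalgebras
  \<open>P_alg n\<close> and \<open>EP_alg n\<close>, in which only the indices $1,\ldots,n$ occur.
\<close>

type_synonym 'p ypoly = "(nat \<Rightarrow>\<^sub>0 nat) \<Rightarrow>\<^sub>0 'p mod_ring"

type_synonym 'p EP = "'p ypoly ext"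

definition yvar :: "nat \<Rightarrow> 'p::prime_card ypoly" where
  "yvar i = Poly_Mapping.single (Poly_Mapping.single i 1) 1"

definition P_alg :: "nat \<Rightarrow> 'p::prime_card ypoly set" where
  "P_alg n = {f. \<forall>m \<in> Poly_Mapping.keys f. Poly_Mapping.keys m \<subseteq> {1..n}}"

definition EP_alg :: "nat \<Rightarrow> 'p::prime_card EP set" where
  "EP_alg n = {z. \<forall>I. ext_coeff z I \<in> P_alg n \<and> (ext_coeff z I \<noteq> 0 \<longrightarrow> I \<subseteq> {1..n})}"


lemma P_alg_0 [simp]: "0 \<in> P_alg n" and P_alg_1 [simp]: "1 \<in> P_alg n"
  by (simp_all add: P_alg_def)

lemma P_alg_add: "f \<in> P_alg n \<Longrightarrow> g \<in> P_alg n \<Longrightarrow> f + g \<in> P_alg n"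
  using Poly_Mapping.keys_add[of f g] by (fastforce simp: P_alg_def)

lemma P_alg_uminus: "f \<in> P_alg n \<Longrightarrow> - f \<in> P_alg n"
  by (simp add: P_alg_def)

lemma P_alg_mult:
  assumes "f \<in> P_alg n" "g \<in> P_alg n"
  shows "f * g \<in> P_alg n"
  unfolding P_alg_def
proof (clarify)
  fix m i assume "m \<in> Poly_Mapping.keys (f * g)" and i: "i \<in> Poly_Mapping.keys m"
  then obtain a b where "m = a + b" "a \<in> Poly_Mapping.keys f" "b \<in> Poly_Mapping.keys g"
    using keys_mult[of f g] by blast
  then show "i \<in> {1..n}"
    using assms i Poly_Mapping.keys_add[of a b] unfolding P_alg_def by blast
qed

lemma P_alg_yvar: "i \<in> {1..n} \<Longrightarrow> yvar i \<in> P_alg n"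
  by (simp add: P_alg_def yvar_def)

lemma P_alg_sum: "(\<And>i. i \<in> A \<Longrightarrow> f i \<in> P_alg n) \<Longrightarrow> sum f A \<in> P_alg n"
  by (induction A rule: infinite_finite_induct) (auto intro: P_alg_add)

lemma P_alg_prod: "(\<And>i. i \<in> A \<Longrightarrow> f i \<in> P_alg n) \<Longrightarrow> prod f A \<in> P_alg n"
  by (induction A rule: infinite_finite_induct) (auto intro: P_alg_mult)

lemma P_alg_power: "f \<in> P_alg n \<Longrightarrow> f ^ m \<in> P_alg n"
  by (induction m) (auto intro: P_alg_mult)

lemma P_alg_det:
  assumes "\<And>i j. i < m \<Longrightarrow> j < m \<Longrightarrow> A i j \<in> P_alg n"
  shows "det (mat m m (\<lambda>(i, j). A i j)) \<in> P_alg n"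
proof -
  have "signof q * (\<Prod>i = 0..<m. mat m m (\<lambda>(i, j). A i j) $$ (i, q i)) \<in> P_alg n"
    if q: "q permutes {0..<m}" for q
  proof (rule P_alg_mult)
    show "signof q \<in> P_alg n"
      by (cases q rule: sign_cases) (auto intro: P_alg_uminus)
    show "(\<Prod>i = 0..<m. mat m m (\<lambda>(i, j). A i j) $$ (i, q i)) \<in> P_alg n"
      using assms permutes_in_image[OF q] by (intro P_alg_prod) auto
  qed
  then show ?thesis
    unfolding det_def by (auto intro: P_alg_sum)
qed

lemma EP_alg_0: "0 \<in> EP_alg n"
  by (simp add: EP_alg_def zero_ext.rep_eq)

lemma EP_alg_add: "a \<in> EP_alg n \<Longrightarrow> b \<in> EP_alg n \<Longrightarrow> a + b \<in> EP_alg n"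
  by (simp add: EP_alg_def plus_ext.rep_eq P_alg_add) (metis add.left_neutral)

lemma EP_alg_uminus: "a \<in> EP_alg n \<Longrightarrow> - a \<in> EP_alg n"
  by (simp add: EP_alg_def uminus_ext.rep_eq P_alg_uminus)

lemma EP_alg_const: "c \<in> P_alg n \<Longrightarrow> ext_const c \<in> EP_alg n"
  by (simp add: EP_alg_def ext_const.rep_eq)

lemma EP_alg_gen: "i \<in> {1..n} \<Longrightarrow> ext_gen i \<in> EP_alg n"
  by (simp add: EP_alg_def ext_gen.rep_eq)

lemma EP_alg_mult:
  assumes a: "a \<in> EP_alg n" and b: "b \<in> EP_alg n"
  shows "a * b \<in> EP_alg n"
proof -
  have "ext_coeff (a * b) K \<in> P_alg n" and "K \<subseteq> {1..n}"
    if nz: "ext_coeff (a * b) K \<noteq> 0" for K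
  proof -
    have K: "finite K" using nz ext_coeff_infinite by blast
    have sgn: "ext_sign I J \<in> P_alg n" for I J
      using ext_sign_cases[of I J] by (metis P_alg_1 P_alg_uminus)
    show "ext_coeff (a * b) K \<in> P_alg n"
      unfolding ext_coeff_times[OF K]
      using a b by (intro P_alg_sum P_alg_mult sgn) (auto simp: EP_alg_def)
    obtain I where I: "I \<in> Pow K"
      "ext_sign I (K - I) * (ext_coeff a I * ext_coeff b (K - I)) \<noteq> 0"
      using sum.not_neutral_contains_not_neutral[OF nz[unfolded ext_coeff_times[OF K]]]
      by blast
    then have "I \<subseteq> {1..n}" "K - I \<subseteq> {1..n}"
      using a b by (auto simp: EP_alg_def)
    then show "K \<subseteq> {1..n}" by blast
  qed
  then show ?thesis
    unfolding EP_alg_def by (smt (verit) P_alg_0 mem_Collect_eq)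
qed

lemma EP_alg_sum: "(\<And>i. i \<in> A \<Longrightarrow> f i \<in> EP_alg n) \<Longrightarrow> sum f A \<in> EP_alg n"
  by (induction A rule: infinite_finite_induct) (auto intro: EP_alg_0 EP_alg_add)


section \<open>Mui invariants and Dickson invariants\<close>

text \<open>The increasing enumeration of the complement of \<open>I\<close> in $\{1,\ldots,n\}$.\<close>

abbreviation compl_list :: "nat \<Rightarrow> nat set \<Rightarrow> nat list" where
  "compl_list n I \<equiv> sorted_list_of_set ({1..n} - I)"

text \<open>The permutation $j \mapsto i_j$ of $\{1,\ldots,n\}$; list positions count from 0.\<close>

definition sigma_perm :: "nat \<Rightarrow> nat set \<Rightarrow> nat \<Rightarrow> nat" where
  "sigma_perm n I j =
    (if j \<in> {1..n} then (sorted_list_of_set I @ compl_list n I) ! (j - 1) else j)"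

text \<open>
  \<open>mui n k a\<close> is $[k; a_{k+1}, \ldots, a_n]$, where $a_j$ is \<open>a j\<close>; the values of \<open>a\<close> outside
  $\{k+1,\ldots,n\}$ play no role. Matrix positions \<open>(u, v)\<close> count from 0 and correspond to
  $(k+1+u, k+1+v)$.
\<close>

definition mui :: "nat \<Rightarrow> nat \<Rightarrow> (nat \<Rightarrow> nat) \<Rightarrow> 'p::prime_card EP" where
  "mui n k a = (\<Sum>I | I \<subseteq> {1..n} \<and> card I = k.
     of_int (sign (sigma_perm n I)) *
     prod_list (map ext_gen (sorted_list_of_set I)) *
     ext_const (det (mat (n - k) (n - k)
       (\<lambda>(u, v). yvar (compl_list n I ! u) ^ (CARD('p) ^ a (k + 1 + v))))))"

text \<open>\<open>ydet n a\<close> is $[a_1, \ldots, a_n]$, as an element of $P(y_1,\ldots,y_n)$.\<close>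

definition ydet :: "nat \<Rightarrow> (nat \<Rightarrow> nat) \<Rightarrow> 'p::prime_card ypoly" where
  "ydet n a = det (mat n n (\<lambda>(i, j). yvar (i + 1) ^ (CARD('p) ^ a (j + 1))))"

text \<open>The $j$-th entry of $(0, \ldots, \hat s, \ldots, n)$ is $j-1$ for $j \le s$ and $j$ for $j > s$.\<close>

definition L_inv :: "nat \<Rightarrow> nat \<Rightarrow> 'p::prime_card ypoly" where
  "L_inv n s = ydet n (\<lambda>j. if j \<le> s then j - 1 else j)"

text \<open>
  The quotient \<open>L_inv n s / L_inv n n\<close>. It is unique, because the polynomial ring is a domain
  and \<open>L_inv n n\<close> is nonzero; its existence is the classical theorem of Dickson.
\<close>

definition Q_inv :: "nat \<Rightarrow> nat \<Rightarrow> 'p::prime_card ypoly" where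
  "Q_inv n s = (THE q. q \<in> P_alg n \<and> L_inv n s = q * L_inv n n)"

lemma mui_0: "mui n 0 a = ext_const (ydet n a)"
proof -
  have I: "{I. I \<subseteq> {1..n} \<and> card I = 0} = {{}}"
    by (auto dest: finite_subset)
  have list: "sorted_list_of_set {Suc 0..n} = [Suc 0..<Suc n]"
    by (metis atLeastLessThanSuc_atLeastAtMost sorted_list_of_set_range)
  have sigma: "sigma_perm n {} = id"
    by (rule HOL.ext) (auto simp: sigma_perm_def list nth_append simp del: upt_Suc)
  have "mat n n (\<lambda>(u, v). yvar ([Suc 0..<Suc n] ! u) ^ (CARD('a) ^ a (1 + v))) =
      mat n n (\<lambda>(i, j). yvar (i + 1) ^ (CARD('a) ^ a (j + 1)) :: 'a ypoly)"
    by (rule eq_matI) (simp_all del: upt_Suc)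
  then show ?thesis
    unfolding mui_def ydet_def I by (simp add: sigma list sign_id del: upt_Suc)
qed

lemma mui_in_EP_alg: "mui n k a \<in> EP_alg n"
  unfolding mui_def
proof (intro EP_alg_sum EP_alg_mult EP_alg_const P_alg_det P_alg_power P_alg_yvar)
  fix I assume "I \<in> {I. I \<subseteq> {1..n} \<and> card I = k}"
  then have I: "I \<subseteq> {1..n}" "card I = k" by auto
  then have fin: "finite I" by (auto intro: finite_subset)
  have one: "1 \<in> EP_alg n" by (metis EP_alg_const P_alg_1 ext_const_1)
  then show "of_int (sign (sigma_perm n I)) \<in> EP_alg n"
    by (cases "sigma_perm n I" rule: sign_cases) (auto intro: EP_alg_uminus)
  have "prod_list (map ext_gen xs) \<in> EP_alg n" if "set xs \<subseteq> {1..n}" for xs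
    using that by (induction xs) (simp_all add: one EP_alg_mult EP_alg_gen)
  then show "prod_list (map ext_gen (sorted_list_of_set I)) \<in> EP_alg n"
    using I(1) fin by (metis set_sorted_list_of_set)
  fix u assume "u < n - k"
  then have "u < length (compl_list n I)"
    using I fin by (simp add: card_Diff_subset)
  then have "compl_list n I ! u \<in> set (compl_list n I)"
    by (rule nth_mem)
  then show "compl_list n I ! u \<in> {1..n}" by simp
qed

end

theory Submission
  imports Defs
begin

text \<open>
  The polynomial $V_n(X) = \prod_v (X - v)$, over all linear combinations $v$ of
  $y_1,\ldots,y_n$, has the form $\sum_{s \le n} c_s X^{p^s}$ with $c_n = 1$, so that each
  $y_i^{p^n}$ is the combination of $y_i, y_i^p, \ldots, y_i^{p^{n-1}}$ with coefficients $-c_s$.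
  By Cramer's rule this forces $L_{n,s} = (-1)^{n-s} c_s L_n$, which proves the divisibility by
  $L_n$ and identifies $Q_{n,s}$. Raising the relation to the power $p^{e_n}$ and substituting
  it into the last column of each determinant in the Mui invariant gives the claim.
\<close>

section \<open>Determinants and columns\<close>

text \<open>Laplace expansion along the last column on the left and along column \<open>s\<close> on
  the right uses the same entries and the same minors. Only the checkerboard signs differ, by the
  factor (-1)^(n-1-s).\<close>

lemma det_move_col_last:
  fixes A :: "nat \<Rightarrow> nat \<Rightarrow> 'a::comm_ring_1"
  assumes "s < n"
  shows "det (mat n n (\<lambda>(i, j). A i (if j < s then j else if j < n - 1 then j + 1 else s))) =
    (- 1) ^ (n - 1 - s) * det (mat n n (\<lambda>(i, j). A i j))" (is "det ?B = _ * det ?A")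
proof -
  have "cofactor ?B i (n - 1) = (- 1) ^ (n - 1 - s) * cofactor ?A i s" if "i < n" for i
  proof -
    have "mat_delete ?B i (n - 1) = mat_delete ?A i s"
      using assms that by (intro eq_matI) (auto simp: mat_delete_def)
    moreover have "(- 1 :: 'a) ^ (i + (n - 1)) = (- 1) ^ (n - 1 - s) * (- 1) ^ (i + s)"
      using assms by (simp add: add.commute flip: power_add)
    ultimately show ?thesis
      by (simp add: cofactor_def)
  qed
  moreover have "det ?B = (\<Sum>i<n. ?B $$ (i, n - 1) * cofactor ?B i (n - 1))"
    using assms by (intro laplace_expansion_column) auto
  moreover have "det ?A = (\<Sum>i<n. ?A $$ (i, s) * cofactor ?A i s)"
    using assms by (intro laplace_expansion_column) auto
  ultimately show ?thesis
    using assms by (auto simp: sum_distrib_left intro!: sum.cong)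
qed

text \<open>Linearity in column \<open>l\<close>: in the expansion along that column the cofactors
  do not see its entries, so they may be computed with zeros in their place.\<close>

lemma det_col_sum:
  fixes A :: "nat \<Rightarrow> nat \<Rightarrow> 'a::comm_ring_1"
  assumes "l < n"
  shows "det (mat n n (\<lambda>(i, j). if j = l then (\<Sum>s\<in>S. d s * f s i) else A i j)) =
    (\<Sum>s\<in>S. d s * det (mat n n (\<lambda>(i, j). if j = l then f s i else A i j)))"
proof -
  let ?M = "\<lambda>g. mat n n (\<lambda>(i, j). if j = l then g i else A i j)"
  have exp: "det (?M g) = (\<Sum>i<n. g i * cofactor (?M (\<lambda>_. 0)) i l)" for g
  proof -
    have "mat_delete (?M g) i l = mat_delete (?M (\<lambda>_. 0)) i l" if "i < n" for i
      using assms that by (intro eq_matI) (auto simp: mat_delete_def)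
    then have "cofactor (?M g) i l = cofactor (?M (\<lambda>_. 0)) i l" if "i < n" for i
      using that by (simp add: cofactor_def)
    moreover have "det (?M g) = (\<Sum>i<n. ?M g $$ (i, l) * cofactor (?M g) i l)"
      using assms by (intro laplace_expansion_column) auto
    ultimately show ?thesis
      using assms by (auto intro!: sum.cong)
  qed
  show ?thesis
    unfolding exp[of "\<lambda>i. \<Sum>s\<in>S. d s * f s i"] exp[of "f _"]
    by (simp add: sum_distrib_left sum_distrib_right mult.assoc) (rule sum.swap)
qed

text \<open>Cramer's lemma: the new column is the matrix times the vector \<open>d\<close>.\<close>

lemma det_col_lincomb:
  fixes A :: "nat \<Rightarrow> nat \<Rightarrow> 'a::comm_ring_1"
  assumes "l < n"
  shows "det (mat n n (\<lambda>(i, j). if j = l then (\<Sum>s<n. d s * A i s) else A i j)) =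
    d l * det (mat n n (\<lambda>(i, j). A i j))"
proof -
  let ?A = "mat n n (\<lambda>(i, j). A i j)"
  have "replace_col ?A (?A *\<^sub>v vec n d) l =
      mat n n (\<lambda>(i, j). if j = l then (\<Sum>s<n. d s * A i s) else A i j)"
    by (rule eq_matI)
      (auto simp: replace_col_def scalar_prod_def lessThan_atLeast0 mult.commute intro!: sum.cong)
  with cramer_lemma_mat[of ?A n "vec n d" l] assms show ?thesis
    by simp
qed

section \<open>The relation satisfied by $y_1,\ldots,y_n$\<close>

lemma CHAR_ypoly: "CHAR('p::prime_card ypoly) = CARD('p)"
proof -
  \<comment> \<open>The characteristic divides p because the coefficients lie in Z/p; being
    different from 1, it equals the prime p.\<close>
  have "(of_nat CARD('p) :: 'p ypoly) = 0"
    by (simp flip: single_of_nat)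
  then have "CHAR('p ypoly) dvd CARD('p)"
    by (simp only: of_nat_eq_0_iff_char_dvd)
  moreover have "CHAR('p ypoly) \<noteq> 1"
    by simp
  ultimately show ?thesis
    using prime_card[where 'a='p] by (auto simp: prime_nat_iff)
qed

lemma ypoly_frobenius_sum:
  fixes f :: "'a \<Rightarrow> 'p::prime_card ypoly"
  shows "sum f S ^ (CARD('p) ^ m) = (\<Sum>s\<in>S. f s ^ (CARD('p) ^ m))"
  by (rule freshmans_dream_sum') (simp_all add: CHAR_ypoly prime_card)

text \<open>
  The coefficients are those of $V_n$, built from the recursion
  $V_{n+1}(X) = V_n(X)^p - V_n(y_{n+1})^{p-1} V_n(X)$.
\<close>

lemma additive_relation:
  "\<exists>c :: nat \<Rightarrow> 'p::prime_card ypoly. (\<forall>s. c s \<in> P_alg n) \<and> c n = 1 \<and>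
    (\<forall>i\<in>{1..n}. (\<Sum>s\<le>n. c s * yvar i ^ (CARD('p) ^ s)) = 0)"
proof (induction n)
  case 0
  \<comment> \<open>V_0(X) = X.\<close>
  show ?case by (intro exI[of _ "\<lambda>_. 1"]) simp
next
  case (Suc n)
  let ?p = "CARD('p)"
  have p: "?p > 0" by simp
  obtain c :: "nat \<Rightarrow> 'p ypoly" where c: "\<And>s. c s \<in> P_alg n" "c n = 1"
    "\<And>i. i \<in> {1..n} \<Longrightarrow> (\<Sum>s\<le>n. c s * yvar i ^ (?p ^ s)) = 0"
    using Suc.IH by blast
  define V where "V x = (\<Sum>s\<le>n. c s * x ^ (?p ^ s))" for x
  define v where "v = V (yvar (Suc n))"
  \<comment> \<open>Coefficient of X^(p^s) in V_n(X)^p - v^(p-1) V_n(X). The guard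
    \<open>s \<le> n\<close> keeps the unspecified value \<open>c (Suc n)\<close> out of the leading
    coefficient.\<close>
  define d where "d s = (if s = 0 then 0 else c (s - 1) ^ ?p) -
    (if s \<le> n then v ^ (?p - 1) * c s else 0)" for s
  have P_mono: "f \<in> P_alg n \<Longrightarrow> f \<in> P_alg (Suc n)" for f :: "'p ypoly"
    unfolding P_alg_def by fastforce
  have v: "v \<in> P_alg (Suc n)"
    unfolding v_def V_def using c(1)
    by (intro P_alg_sum P_alg_mult P_alg_power P_alg_yvar P_mono) auto
  have diff: "f \<in> P_alg m \<Longrightarrow> g \<in> P_alg m \<Longrightarrow> f - g \<in> P_alg m" for f g :: "'p ypoly" and m
    using P_alg_add[of f m "- g"] P_alg_uminus by auto
  have "d s \<in> P_alg (Suc n)" for s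
    unfolding d_def using v P_mono[OF c(1)]
    by (intro diff) (simp_all add: P_alg_mult P_alg_power)
  moreover have "d (Suc n) = 1"
    by (simp add: d_def c(2))
  moreover have "(\<Sum>s\<le>Suc n. d s * yvar i ^ (?p ^ s)) = 0" if "i \<in> {1..Suc n}" for i
  proof -
    define x :: "'p ypoly" where "x = yvar i"
    have "V x ^ ?p = (\<Sum>s\<le>n. c s ^ ?p * x ^ (?p ^ Suc s))"
      unfolding V_def using ypoly_frobenius_sum[of "\<lambda>s. c s * x ^ (?p ^ s)" "{..n}" 1]
      by (simp add: power_mult_distrib mult.commute flip: power_mult)
    \<comment> \<open>The p-th power moves the coefficient at \<open>s\<close> to
      \<open>s + 1\<close>, leaving 0 at index 0.\<close>
    also have "\<dots> = (\<Sum>s\<le>Suc n. (if s = 0 then 0 else c (s - 1) ^ ?p) * x ^ (?p ^ s))"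
      by (subst sum.atMost_Suc_shift) simp
    finally have "(\<Sum>s\<le>Suc n. d s * x ^ (?p ^ s)) = V x ^ ?p - v ^ (?p - 1) * V x"
      by (simp add: d_def V_def left_diff_distrib sum_subtractf sum_distrib_left mult.assoc)
    also have "\<dots> = 0"
    \<comment> \<open>For the new variable V x = v, so the two terms cancel; for the old ones V x =
      0 by induction.\<close>
    proof (cases "i = Suc n")
      case True
      then show ?thesis
        using p by (simp add: x_def v_def power_eq_if[of _ ?p] mult.commute)
    next
      case False
      then have "V x = 0"
        using that c(3) by (simp add: V_def x_def)
      then show ?thesis
        using p by simp
    qed
    finally show ?thesis
      by (simp add: x_def)
  qed
  ultimately show ?case by blast
qed

lemma yvar_power: "yvar i ^ m = Poly_Mapping.single (Poly_Mapping.single i m) 1"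
  by (induction m) (simp_all add: yvar_def mult_single flip: single_add)

text \<open>The pure monomial y_(n+1)^(p^n) survives with coefficient 1: since no \<open>c s\<close>
  involves y_(n+1), the terms with s < n contain this variable only to the power p^s.\<close>

lemma yvar_not_root:
  fixes c :: "nat \<Rightarrow> 'p::prime_card ypoly"
  assumes c: "\<And>s. c s \<in> P_alg n" "c n = 1"
  shows "(\<Sum>s\<le>n. c s * yvar (Suc n) ^ (CARD('p) ^ s)) \<noteq> 0"
proof
  let ?p = "CARD('p)"
  let ?m = "Poly_Mapping.single (Suc n) (?p ^ n)"
  assume 0: "(\<Sum>s\<le>n. c s * yvar (Suc n) ^ (?p ^ s)) = 0"
  have "Poly_Mapping.lookup (c s * yvar (Suc n) ^ (?p ^ s)) ?m = 0" if "s < n" for s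
  proof (rule ccontr)
    assume "Poly_Mapping.lookup (c s * yvar (Suc n) ^ (?p ^ s)) ?m \<noteq> 0"
    then have "?m \<in> Poly_Mapping.keys (c s * yvar (Suc n) ^ (?p ^ s))"
      by (simp add: in_keys_iff)
    then obtain a where a: "a \<in> Poly_Mapping.keys (c s)"
      "?m = a + Poly_Mapping.single (Suc n) (?p ^ s)"
      using keys_mult[of "c s" "yvar (Suc n) ^ (?p ^ s)"]
      by (auto simp: yvar_power)
    have "Suc n \<notin> Poly_Mapping.keys a"
      using a(1) c(1)[of s] unfolding P_alg_def by fastforce
    then have "Poly_Mapping.lookup a (Suc n) = 0"
      by (simp add: in_keys_iff)
    then have "?p ^ n = ?p ^ s"
      using arg_cong[OF a(2), of "\<lambda>m. Poly_Mapping.lookup m (Suc n)"]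
      by (simp add: lookup_add)
    then show False
      using that prime_gt_1_nat[OF prime_card[where 'a='p]] by (simp add: power_inject_exp)
  qed
  moreover have "Poly_Mapping.lookup (c n * yvar (Suc n) ^ (?p ^ n)) ?m = 1"
    by (simp add: c(2) yvar_power)
  ultimately have "Poly_Mapping.lookup (\<Sum>s\<le>n. c s * yvar (Suc n) ^ (?p ^ s)) ?m = 1"
    by (simp add: lookup_add lookup_sum flip: lessThan_Suc_atMost)
  with 0 show False by simp
qed

section \<open>Dickson invariants\<close>

lemma L_inv_self:
  "L_inv n n = det (mat n n (\<lambda>(i, j). yvar (i + 1) ^ (CARD('p::prime_card) ^ j)) :: 'p ypoly mat)"
  unfolding L_inv_def ydet_def by (intro arg_cong[of _ _ det] eq_matI) auto

text \<open>Induction through the factorization L_(n+1) = V_n(y_(n+1)) L_n, whose first factor is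
  nonzero by \<open>yvar_not_root\<close>.\<close>

lemma L_inv_nonzero: "L_inv n n \<noteq> (0 :: 'p::prime_card ypoly)"
proof (induction n)
  case 0
  show ?case by (simp add: L_inv_self)
next
  case (Suc n)
  let ?p = "CARD('p)"
  obtain c :: "nat \<Rightarrow> 'p ypoly" where c: "\<And>s. c s \<in> P_alg n" "c n = 1"
    "\<And>i. i \<in> {1..n} \<Longrightarrow> (\<Sum>s\<le>n. c s * yvar i ^ (?p ^ s)) = 0"
    using additive_relation[where 'p='p and n=n] by blast
  let ?V = "\<lambda>i. \<Sum>s\<le>n. c s * yvar (i + 1) ^ (?p ^ s)"
  let ?B = "mat (Suc n) (Suc n) (\<lambda>(i, j). if j = n then ?V i else yvar (i + 1) ^ (?p ^ j))"
  \<comment> \<open>Replacing the last column by V_n(y_1), ..., V_n(y_(n+1)) preserves the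
    determinant because \<open>c n = 1\<close>. All its entries but the bottom one vanish.\<close>
  have "L_inv (Suc n) (Suc n) = det ?B"
    unfolding L_inv_self
    using det_col_lincomb[of n "Suc n" c "\<lambda>i j. yvar (i + 1) ^ (?p ^ j)",
      unfolded lessThan_Suc_atMost c(2)]
    by simp
  also have "\<dots> = (\<Sum>i<Suc n. ?B $$ (i, n) * cofactor ?B i n)"
    by (intro laplace_expansion_column) auto
  also have "\<dots> = ?V n * cofactor ?B n n"
    using c(3) by simp
  also have "mat_delete ?B n n = mat n n (\<lambda>(i, j). yvar (i + 1) ^ (?p ^ j))"
    by (intro eq_matI) (auto simp: mat_delete_def)
  then have "cofactor ?B n n = L_inv n n"
    by (simp add: cofactor_def L_inv_self)
  finally show ?case
    using Suc.IH yvar_not_root[of c n, OF c(1,2)] by simp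
qed

text \<open>Cancelling the nonzero L_n in a domain gives the uniqueness that the definite
  description requires.\<close>

lemma Q_inv_eqI:
  assumes "q \<in> P_alg n" "L_inv n s = q * L_inv n n"
  shows "Q_inv n s = q"
  unfolding Q_inv_def using assms L_inv_nonzero[of n]
  by (intro the_equality) auto

lemma L_inv_eq_mult:
  fixes d :: "nat \<Rightarrow> 'p::prime_card ypoly"
  assumes "s < n"
    and rel: "\<And>i. i \<in> {1..n} \<Longrightarrow> yvar i ^ (CARD('p) ^ n) = (\<Sum>s<n. d s * yvar i ^ (CARD('p) ^ s))"
  shows "L_inv n s = (- 1) ^ (n - 1 - s) * d s * L_inv n n"
proof -
  let ?y = "\<lambda>i j. yvar (i + 1) ^ (CARD('p) ^ j) :: 'p ypoly"
  \<comment> \<open>The matrix of L_n with its column \<open>s\<close> replaced by the p^n-th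
    powers; L_(n,s) has that column in last place instead.\<close>
  let ?A = "\<lambda>i j. if j = s then ?y i n else ?y i j"
  have "L_inv n s =
      det (mat n n (\<lambda>(i, j). ?A i (if j < s then j else if j < n - 1 then j + 1 else s)))"
    unfolding L_inv_def ydet_def using assms(1)
    by (cases n) (auto simp: less_Suc_eq intro!: arg_cong[of _ _ det] eq_matI)
  also have "\<dots> = (- 1) ^ (n - 1 - s) * det (mat n n (\<lambda>(i, j). ?A i j))"
    by (rule det_move_col_last[OF assms(1)])
  also have "mat n n (\<lambda>(i, j). ?A i j) =
      mat n n (\<lambda>(i, j). if j = s then (\<Sum>t<n. d t * ?y i t) else ?y i j)"
    by (intro eq_matI) (auto simp: rel)
  also have "det \<dots> = d s * L_inv n n"
    unfolding L_inv_self by (rule det_col_lincomb[OF assms(1)])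
  finally show ?thesis
    by (simp add: mult.assoc)
qed

text \<open>Cramer's rule turns the coefficients -c_s of the additive relation into Dickson
  invariants up to sign.\<close>

lemma yvar_dickson_relation:
  assumes i: "i \<in> {1..n}"
  shows "yvar i ^ (CARD('p) ^ n) =
    (\<Sum>s<n. (- 1) ^ (n + s - 1) * Q_inv n s * yvar i ^ (CARD('p) ^ s) :: 'p::prime_card ypoly)"
proof -
  let ?p = "CARD('p)"
  obtain c :: "nat \<Rightarrow> 'p ypoly" where c: "\<And>s. c s \<in> P_alg n" "c n = 1"
    "\<And>i. i \<in> {1..n} \<Longrightarrow> (\<Sum>s\<le>n. c s * yvar i ^ (?p ^ s)) = 0"
    using additive_relation[where 'p='p and n=n] by blast
  have rel: "yvar i ^ (?p ^ n) = (\<Sum>s<n. - c s * yvar i ^ (?p ^ s))" if "i \<in> {1..n}" for i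
    using c(3)[OF that]
    by (simp add: c(2) sum_negf add_eq_0_iff flip: lessThan_Suc_atMost)
  \<comment> \<open>The exponents differ by 2s.\<close>
  have sign: "(- 1 :: 'p ypoly) ^ (n - 1 - s) = (- 1) ^ (n + s - 1)" if "s < n" for s
    using that by (auto simp: minus_one_power_iff)
  have "Q_inv n s = (- 1) ^ (n + s - 1) * - c s" if "s < n" for s
  proof (rule Q_inv_eqI)
    show "(- 1) ^ (n + s - 1) * - c s \<in> P_alg n"
      by (intro P_alg_mult P_alg_power P_alg_uminus c(1)) simp
    show "L_inv n s = (- 1) ^ (n + s - 1) * - c s * L_inv n n"
      using L_inv_eq_mult[OF that, of "\<lambda>s. - c s"] rel sign[OF that] by simp
  qed
  \<comment> \<open>The sign squares to 1.\<close>
  then have "(- 1) ^ (n + s - 1) * Q_inv n s = - c s" if "s < n" for s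
    using that by (simp add: mult.assoc flip: power_mult_distrib mult.assoc)
  then show ?thesis
    unfolding rel[OF i] by simp
qed

section \<open>The recursion for Mui invariants\<close>

theorem proposition1p2:
  fixes p n k :: nat and e :: "nat \<Rightarrow> nat"
  assumes "p = CARD('p::prime_card)" and "odd p"
    and "n \<ge> 1" and "k < n"
  shows "(mui n k (e(n := e n + n)) :: 'p EP) =
    (\<Sum>s = 0..n - 1. (- 1) ^ (n + s - 1) *
       mui n k (e(n := e n + s)) * ext_const (Q_inv n s ^ (p ^ e n)))"
proof -
  \<comment> \<open>Coefficients of the Dickson relation raised to the power p^(e_n), to be applied
    to the last column of each minor.\<close>
  define w :: "nat \<Rightarrow> 'p ypoly" where "w s = (- 1) ^ (n + s - 1) * Q_inv n s ^ (p ^ e n)" for s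
  define D :: "nat set \<Rightarrow> nat \<Rightarrow> 'p ypoly" where
    "D I t = det (mat (n - k) (n - k)
       (\<lambda>(u, v). yvar (compl_list n I ! u) ^ (CARD('p) ^ (e(n := e n + t)) (k + 1 + v))))" for I t
  define X :: "nat set \<Rightarrow> 'p EP" where
    "X I = of_int (sign (sigma_perm n I)) * prod_list (map ext_gen (sorted_list_of_set I))" for I
  have mui: "mui n k (e(n := e n + t)) =
      (\<Sum>I | I \<subseteq> {1..n} \<and> card I = k. X I * ext_const (D I t))" for t
    by (simp add: mui_def D_def X_def)
  have y: "yvar i ^ (p ^ (e n + n)) = (\<Sum>s<n. w s * yvar i ^ (p ^ (e n + s)) :: 'p ypoly)"
    if "i \<in> {1..n}" for i
  proof -
    have "yvar i ^ (p ^ (e n + n)) = (yvar i ^ (p ^ n) :: 'p ypoly) ^ (p ^ e n)"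
      by (simp add: power_add mult.commute flip: power_mult)
    also have "\<dots> = (\<Sum>s<n. ((- 1) ^ (n + s - 1) * Q_inv n s * yvar i ^ (p ^ s)) ^ (p ^ e n))"
      unfolding assms(1) yvar_dickson_relation[OF that] by (rule ypoly_frobenius_sum)
    also have "\<dots> = (\<Sum>s<n. w s * yvar i ^ (p ^ (e n + s)))"
    proof (rule sum.cong[OF refl])
      fix s
      \<comment> \<open>An odd power leaves the sign unchanged; this is where p odd enters.\<close>
      have "((- 1 :: 'p ypoly) ^ (n + s - 1)) ^ (p ^ e n) = (- 1) ^ (n + s - 1)"
        using assms(2) by (simp add: minus_one_power_iff)
      moreover have "(yvar i ^ (p ^ s) :: 'p ypoly) ^ (p ^ e n) = yvar i ^ (p ^ (e n + s))"
        by (simp add: power_add mult.commute flip: power_mult)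
      ultimately show "((- 1) ^ (n + s - 1) * Q_inv n s * yvar i ^ (p ^ s)) ^ (p ^ e n) =
          w s * yvar i ^ (p ^ (e n + s))"
        by (simp only: power_mult_distrib w_def)
    qed
    finally show ?thesis .
  qed
  have D: "D I n = (\<Sum>s<n. w s * D I s)" if I: "I \<subseteq> {1..n}" "card I = k" for I
  proof -
    define z where "z u = compl_list n I ! u" for u
    have z: "z u \<in> {1..n}" if "u < n - k" for u
    proof -
      have "finite I" using I(1) by (auto intro: finite_subset)
      then have "u < length (compl_list n I)"
        using that I by (simp add: card_Diff_subset)
      then have "z u \<in> set (compl_list n I)"
        unfolding z_def by (rule nth_mem)
      then show ?thesis by simp
    qed
    \<comment> \<open>Position n-k-1 is the column of index n, the only one in which
      \<open>D I t\<close> depends on \<open>t\<close>.\<close>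
    let ?M = "\<lambda>g :: nat \<Rightarrow> 'p ypoly. mat (n - k) (n - k)
      (\<lambda>(u, v). if v = n - k - 1 then g u else yvar (z u) ^ (p ^ e (k + 1 + v)))"
    have M: "D I t = det (?M (\<lambda>u. yvar (z u) ^ (p ^ (e n + t))))" for t
      unfolding D_def using assms(1,4)
      by (intro arg_cong[of _ _ det] eq_matI) (auto simp: z_def)
    have "D I n = det (?M (\<lambda>u. \<Sum>s<n. w s * yvar (z u) ^ (p ^ (e n + s))))"
      unfolding M by (intro arg_cong[of _ _ det] eq_matI) (auto simp: y[OF z])
    also have "\<dots> = (\<Sum>s<n. w s * det (?M (\<lambda>u. yvar (z u) ^ (p ^ (e n + s)))))"
      using assms(4) by (intro det_col_sum) simp
    finally show ?thesis
      unfolding M .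
  qed
  have ext_const_sum: "ext_const (sum f S) = (\<Sum>s\<in>S. ext_const (f s) :: 'p EP)"
    if "finite S" for f and S :: "nat set"
    using that by (induction S) (simp_all add: ext_const_add ext_const.rep_eq ext_eqI zero_ext.rep_eq)
  have w: "a * ext_const (w s) = (- 1) ^ (n + s - 1) * a * ext_const (Q_inv n s ^ (p ^ e n))"
    for a :: "'p EP" and s
  proof -
    have "ext_const (- x) = (- ext_const x :: 'p EP)" for x
      by (rule ext_eqI) (simp add: ext_const.rep_eq uminus_ext.rep_eq)
    then show ?thesis
      by (simp add: w_def minus_one_power_iff)
  qed
  \<comment> \<open>The factors \<open>X I\<close> and the weights \<open>w s\<close> do not depend
    on each other's index, so exchanging the sums reassembles one Mui invariant for each
    \<open>s\<close>.\<close>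
  have "mui n k (e(n := e n + n)) =
      (\<Sum>I | I \<subseteq> {1..n} \<and> card I = k. \<Sum>s<n. X I * ext_const (D I s) * ext_const (w s))"
    unfolding mui
    by (intro sum.cong refl)
      (simp add: D ext_const_sum sum_distrib_left mult.commute[of "w _"] ext_const_mult mult.assoc)
  also have "\<dots> = (\<Sum>s<n. mui n k (e(n := e n + s)) * ext_const (w s))"
    by (subst sum.swap) (simp add: mui sum_distrib_right)
  also have "{..<n} = {0..n - 1}"
    using assms(3) by auto
  finally show ?thesis
    by (simp only: w)
qed

end
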